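(* Let $D$ be a set with a given family $\mathcal{F}$ of subsets of $D$. Let $e$ be an expression whose operation symbols are unary or binary, let $I$ be an interpretation for $e$ with domain $D$, and let $I'$ be a continuous set extension of $I$. Let $f$ be the function computed by $e$ under $I$ and let $F$ be the function computed by $e$ under $I'$. Then $F$ is a continuous set extension of $f$.
   Context: Functions are partial: $f\in S\to T$ means that $f$ associates each element of a subset $\mathrm{dom}(f)\subset S$ with a unique element of $T$; $f$ is total if $\mathrm{dom}(f)=S$. For $X\subset S$, $\{f(x)\mid x\in X\}$ means the set of $y\in T$ such that $f$ associates some $x\in X$ with $y$. The composition $g\circ f$ of $f\in S\to T$ and $g\in T\to U$ associates $x$ with $z$ iff there is $y$ with $f$ mapping $x$ to $y$ and $g$ mapping $y$ to $z$. For $f_1\in S_1\to T_1$, $f_2\in S_2\to T_2$, the function $f_1\times f_2\in S_1\times S_2\to T_1\times T_2$ has domain $\mathrm{dom}(f_1)\times\mathrm{dom}(f_2)$ and maps $\langle x_1,x_2\rangle$ to $\langle f_1(x_1),f_2(x_2)\rangle$. $\mathcal{P}(S)$ is the power set of $S$. Expressions: a variable is an expression; if $E$ is an expression and $\varphi$ a unary operation symbol, then $\varphi E$ is an expression; if $E_1,E_2$ are expressions and $\diamond$ is a binary operation symbol, then $E_1\diamond E_2$ is an expression. The variable sequence of $e$ is the sequence of its distinct variables in order of first occurrence. An interpretation for an expression consists of a set $D$ (its domain) and a map $M$ sending each $n$-ary operation symbol in the expression to a (partial) function in $D^n\to D$, $n\in\{1,2\}$. Distribution function: let $e_1,e_2$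 have variable sequences $\langle v_1,\ldots,v_m\rangle$ and $\langle w_1,\ldots,w_n\rangle$, and let $w_{j_1},\ldots,w_{j_q}$ ($j_1<\cdots<j_q$) be those $w_j$ that do not occur in $e_1$ (so the variable sequence of $e_1\diamond e_2$ is $\langle v_1,\ldots,v_m,w_{j_1},\ldots,w_{j_q}\rangle$). The distribution function $\delta\in D^{m+q}\to D^m\times D^n$ for $\langle e_1,e_2\rangle$ and $D$ maps $\langle x_1,\ldots,x_m,y_{j_1},\ldots,y_{j_q}\rangle$ to $\langle\langle x_1,\ldots,x_m\rangle,\langle y_1,\ldots,y_n\rangle\rangle$, where for each $w_i$ occurring in $e_1$, say $w_i=v_k$, one has $y_i=x_k$. Function computed by $e$ under an interpretation with domain $D$ and map $M$, by recursion: if $e$ is a variable, it is the identity on $D$; if $e$ is $\varphi e_1$, it is $M(\varphi)\circ f_1$ where $f_1$ is the function computed by $e_1$; if $e$ is $e_1\diamond e_2$, it is $M(\diamond)\circ(f_1\times f_2)\circ\delta$, where $f_1,f_2$ are the functions computed by $e_1,e_2$ and $\delta$ is the distribution function for $\langle e_1,e_2\rangle$ and $D$. It is a function in $D^k\to D$ where $k$ is the number of distinct variables of $e$. Set extension: for $f\in S\to T$, a total function $F\in\mathcal{P}(S)\to\mathcal{P}(T)$ is a set extension of $f$ iff $\{f(x)\mid x\in X\}\subset F(X)$ for all $X\subset S$. When $S=D^n$ and $F\in\mathcal{P}(D)^n\to\mathcal{P}(D)$ (total) takes tuples of sets as arguments, a tuple $\langle A_1,\ldots,A_n\rangle$ stands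 for the set $A_1\times\cdots\times A_n$, and the condition reads $\{f(x)\mid x\in A_1\times\cdots\times A_n\}\subset F(A_1,\ldots,A_n)$ for all $A_1,\ldots,A_n\subset D$. Convergence: a sequence $\langle S_i\rangle_{i\in\mathbb{N}}$ of subsets of a set $D$ converges with respect to a family $\mathcal{G}$ of subsets of $D$ if it is nested ($S_{i+1}\subset S_i$), each $S_i\in\mathcal{G}$, and $\bigcap_i S_i=\{a\}$ for some $a\in D$; $\{a\}$ is its limit. Continuity: given families $\mathcal{F}_1,\mathcal{F}_2$ of subsets of $S$ and $T$, $F\in\mathcal{P}(S)\to\mathcal{P}(T)$ is continuous w.r.t. $\mathcal{F}_1$ and $\mathcal{F}_2$ in $\{a\}$ iff for every sequence $\langle A_i\rangle$ converging w.r.t. $\mathcal{F}_1$ with limit $\{a\}$, the sequence $\langle F(A_i)\rangle$ converges w.r.t. $\mathcal{F}_2$. For functions with arguments in $D^n$, the family used on the source side is $\mathcal{F}_n$, the family of all Cartesian products $A_1\times\cdots\times A_n$ with $A_1,\ldots,A_n\in\mathcal{F}$; the family on the target side is $\mathcal{F}$. A set extension $F$ of $f\in D^n\to D$ is called continuous if it is continuous w.r.t. $\mathcal{F}_n$ and $\mathcal{F}$ in $\{a\}$ for every $a\in\mathrm{dom}(f)$. A set extension $I'$ of an interpretation $I$ with domain $D$ and map $M$ is an interpretation with domain $\mathcal{P}(D)$ that maps each operation symbol $p$ to a set extension of $M(p)$; it is continuous if each $p$ is mapped to a continuous set extension of $M(p)$. *)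

theory Defs
  imports Main
begin

text \<open>
  Partial functions are maps \<^typ>\<open>'s \<rightharpoonup> 't\<close>.  The elements of $D^n$ are the lists of length
  $n$ over $D$; in particular $D$ itself, as the source of a unary function, is
  identified with the one-element lists, and $D \times D$ with the two-element lists.
\<close>

definition pfuns :: "'s set \<Rightarrow> 't set \<Rightarrow> ('s \<rightharpoonup> 't) set" where
  "pfuns S T = {f. dom f \<subseteq> S \<and> ran f \<subseteq> T}"

definition tuples :: "nat \<Rightarrow> 'd set \<Rightarrow> 'd list set" where
  "tuples n D = {xs. length xs = n \<and> set xs \<subseteq> D}"

definition prod_pfun :: "('s1 \<rightharpoonup> 't1) \<Rightarrow> ('s2 \<rightharpoonup> 't2) \<Rightarrow> ('s1 \<times> 's2 \<rightharpoonup> 't1 \<times> 't2)" where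
  "prod_pfun f1 f2 = (\<lambda>(x1, x2).
     case (f1 x1, f2 x2) of (Some y1, Some y2) \<Rightarrow> Some (y1, y2) | _ \<Rightarrow> None)"


subsection \<open>Expressions\<close>

datatype (vars: 'v, unops: 'u, binops: 'b) expr =
    Var 'v
  | Unary 'u "('v, 'u, 'b) expr"
  | Binary 'b "('v, 'u, 'b) expr" "('v, 'u, 'b) expr"

primrec occurrences :: "('v, 'u, 'b) expr \<Rightarrow> 'v list" where
  "occurrences (Var v) = [v]"
| "occurrences (Unary p e) = occurrences e"
| "occurrences (Binary p e1 e2) = occurrences e1 @ occurrences e2"

text \<open>\<^const>\<open>remdups\<close> keeps last occurrences; the reversals make it keep the first ones.\<close>

definition varseq :: "('v, 'u, 'b) expr \<Rightarrow> 'v list" where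
  "varseq e = rev (remdups (rev (occurrences e)))"

lemma remdups_append_filter:
  "remdups (xs @ ys) = filter (\<lambda>x. x \<notin> set ys) (remdups xs) @ remdups ys"
  by (induction xs) auto

lemma varseq_simps [simp]:
  "varseq (Var v) = [v]"
  "varseq (Unary p e) = varseq e"
  "varseq (Binary p e1 e2) = varseq e1 @ filter (\<lambda>w. w \<notin> set (varseq e1)) (varseq e2)"
  by (simp_all add: varseq_def remdups_append_filter rev_filter)

lemma distinct_varseq [simp]: "distinct (varseq e)"
  by (simp add: varseq_def)

lemma set_varseq [simp]: "set (varseq e) = vars e"
  by (induction e) auto


subsection \<open>Interpretations and computed functions\<close>

record ('u, 'b, 'd) interp =
  idom :: "'d set"
  un_op :: "'u \<Rightarrow> 'd list \<rightharpoonup> 'd"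
  bin_op :: "'b \<Rightarrow> 'd list \<rightharpoonup> 'd"

text \<open>The values at operation symbols not occurring in the expression are irrelevant.\<close>

definition interpretation_for :: "('v, 'u, 'b) expr \<Rightarrow> ('u, 'b, 'd) interp \<Rightarrow> bool" where
  "interpretation_for e I \<longleftrightarrow>
     (\<forall>p \<in> unops e. un_op I p \<in> pfuns (tuples 1 (idom I)) (idom I)) \<and>
     (\<forall>p \<in> binops e. bin_op I p \<in> pfuns (tuples 2 (idom I)) (idom I))"

text \<open>
  The lookup below is in the variable sequence of the compound expression: a variable
  of \<open>e2\<close> that occurs in \<open>e1\<close> shares the component of that variable of \<open>e1\<close>,
  any other variable of \<open>e2\<close> gets its own component.
\<close>

definition distribution ::
  "('v, 'u, 'b) expr \<Rightarrow> ('v, 'u, 'b) expr \<Rightarrow> 'd set \<Rightarrow> ('d list \<rightharpoonup> 'd list \<times> 'd list)" where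
  "distribution e1 e2 D xs =
     (let us = varseq e1 @ filter (\<lambda>w. w \<notin> set (varseq e1)) (varseq e2) in
      if xs \<in> tuples (length us) D
      then Some (take (length (varseq e1)) xs,
                 map (\<lambda>w. the (map_of (zip us xs) w)) (varseq e2))
      else None)"

primrec computed :: "('u, 'b, 'd) interp \<Rightarrow> ('v, 'u, 'b) expr \<Rightarrow> ('d list \<rightharpoonup> 'd)" where
  "computed I (Var v) = (\<lambda>xs. if xs \<in> tuples 1 (idom I) then Some (hd xs) else None)"
| "computed I (Unary p e) = un_op I p \<circ>\<^sub>m (\<lambda>y. Some [y]) \<circ>\<^sub>m computed I e"
| "computed I (Binary p e1 e2) =
     bin_op I p \<circ>\<^sub>m (\<lambda>(y, z). Some [y, z]) \<circ>\<^sub>m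
     prod_pfun (computed I e1) (computed I e2) \<circ>\<^sub>m distribution e1 e2 (idom I)"


subsection \<open>Set extensions\<close>

text \<open>
  A tuple \<open>As\<close> of sets stands for its Cartesian product \<^term>\<open>listset As\<close>.
\<close>

definition set_extension ::
  "nat \<Rightarrow> 'd set \<Rightarrow> ('d list \<rightharpoonup> 'd) \<Rightarrow> ('d set list \<rightharpoonup> 'd set) \<Rightarrow> bool" where
  "set_extension n D f F \<longleftrightarrow>
     F \<in> pfuns (tuples n (Pow D)) (Pow D) \<and>
     dom F = tuples n (Pow D) \<and>
     (\<forall>As \<in> tuples n (Pow D). {y. \<exists>x \<in> listset As. f x = Some y} \<subseteq> the (F As))"


subsection \<open>Convergence and continuity\<close>

definition converges_to :: "'s set \<Rightarrow> 's set set \<Rightarrow> (nat \<Rightarrow> 's set) \<Rightarrow> 's \<Rightarrow> bool" where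
  "converges_to S \<G> A a \<longleftrightarrow>
     (\<forall>i. A i \<subseteq> S) \<and> (\<forall>i. A (Suc i) \<subseteq> A i) \<and> (\<forall>i. A i \<in> \<G>) \<and>
     a \<in> S \<and> (\<Inter>i. A i) = {a}"

definition converges :: "'s set \<Rightarrow> 's set set \<Rightarrow> (nat \<Rightarrow> 's set) \<Rightarrow> bool" where
  "converges S \<G> A \<longleftrightarrow> (\<exists>a. converges_to S \<G> A a)"

definition product_family :: "nat \<Rightarrow> 'd set set \<Rightarrow> 'd list set set" where
  "product_family n \<F> = listset ` tuples n \<F>"

definition continuous_in ::
  "nat \<Rightarrow> 'd set \<Rightarrow> 'd set set \<Rightarrow> ('d set list \<rightharpoonup> 'd set) \<Rightarrow> 'd list \<Rightarrow> bool" where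
  "continuous_in n D \<F> F a \<longleftrightarrow>
     (\<forall>As. (\<forall>i. As i \<in> tuples n (Pow D)) \<and>
           converges_to (tuples n D) (product_family n \<F>) (\<lambda>i. listset (As i)) a \<longrightarrow>
           (\<exists>B. (\<forall>i. F (As i) = Some (B i)) \<and> converges D \<F> B))"

definition continuous_set_extension ::
  "nat \<Rightarrow> 'd set \<Rightarrow> 'd set set \<Rightarrow> ('d list \<rightharpoonup> 'd) \<Rightarrow> ('d set list \<rightharpoonup> 'd set) \<Rightarrow> bool" where
  "continuous_set_extension n D \<F> f F \<longleftrightarrow>
     set_extension n D f F \<and> (\<forall>a \<in> dom f. continuous_in n D \<F> F a)"

definition set_extension_interp ::
  "('v, 'u, 'b) expr \<Rightarrow> ('u, 'b, 'd) interp \<Rightarrow> ('u, 'b, 'd set) interp \<Rightarrow> bool" where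
  "set_extension_interp e I I' \<longleftrightarrow>
     interpretation_for e I' \<and> idom I' = Pow (idom I) \<and>
     (\<forall>p \<in> unops e. set_extension 1 (idom I) (un_op I p) (un_op I' p)) \<and>
     (\<forall>p \<in> binops e. set_extension 2 (idom I) (bin_op I p) (bin_op I' p))"

definition continuous_set_extension_interp ::
  "('v, 'u, 'b) expr \<Rightarrow> 'd set set \<Rightarrow>
   ('u, 'b, 'd) interp \<Rightarrow> ('u, 'b, 'd set) interp \<Rightarrow> bool" where
  "continuous_set_extension_interp e \<F> I I' \<longleftrightarrow>
     set_extension_interp e I I' \<and>
     (\<forall>p \<in> unops e. continuous_set_extension 1 (idom I) \<F> (un_op I p) (un_op I' p)) \<and>
     (\<forall>p \<in> binops e. continuous_set_extension 2 (idom I) \<F> (bin_op I p) (bin_op I' p))"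

end

theory Submission
  imports Defs
begin

text \<open>
  A sequence of nonempty products converges iff each of its factor sequences does, so projecting and
  duplicating arguments preserves convergence.  The limit of \<open>F (A i)\<close> is determined by
  the extension property: every \<open>F (A i)\<close> contains \<open>f a\<close>, so the one-point limit must be
  \<open>{f a}\<close>.  Hence continuous set extensions can be composed, and the theorem follows by
  induction on \<open>e\<close>.
\<close>

section \<open>Products of sets and componentwise convergence\<close>

lemma listset_iff:
  "xs \<in> listset As \<longleftrightarrow> length xs = length As \<and> (\<forall>k<length As. xs ! k \<in> As ! k)"
proof (induction As arbitrary: xs)
  case (Cons A As)
  show ?case
    by (cases xs) (auto simp: set_Cons_def Cons.IH nth_Cons less_Suc_eq_0_disj split: nat.split)
qed simp

lemma tuples_iff:
  "xs \<in> tuples n D \<longleftrightarrow> length xs = n \<and> (\<forall>k<n. xs ! k \<in> D)"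
  by (auto simp: tuples_def in_set_conv_nth subset_iff)

text \<open>The point \<open>xs\<close> keeps the first product nonempty; otherwise one empty factor
  would make the inclusion hold whatever the other factors are. Changing \<open>xs\<close> at a
  single position tests the factor there in isolation.\<close>

lemma listset_mono_iff:
  assumes "xs \<in> listset As" and "length As = length Bs"
  shows "listset As \<subseteq> listset Bs \<longleftrightarrow> (\<forall>k<length As. As ! k \<subseteq> Bs ! k)"
proof
  assume sub: "listset As \<subseteq> listset Bs"
  show "\<forall>k<length As. As ! k \<subseteq> Bs ! k"
  proof (intro allI impI subsetI)
    fix k y assume "k < length As" and "y \<in> As ! k"
    then have "xs[k := y] \<in> listset As"
      using assms(1) by (auto simp: listset_iff nth_list_update)
    then have "xs[k := y] \<in> listset Bs"
      using sub by blast
    then show "y \<in> Bs ! k"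
      using \<open>k < length As\<close> assms by (auto simp: listset_iff)
  qed
qed (use assms(2) in \<open>auto simp: listset_iff subset_iff\<close>)

text \<open>Monotonicity in both directions. This recovers the factors of a nonempty product, which
  matters because \<open>product_family\<close> is an image under \<open>listset\<close> and forgets
  them.\<close>

lemma listset_inj:
  assumes "xs \<in> listset As" and "listset As = listset Bs"
  shows "As = Bs"
proof -
  have len: "length As = length Bs"
    using assms by (metis listset_iff)
  have "As ! k = Bs ! k" if "k < length As" for k
    using listset_mono_iff[OF assms(1) len] listset_mono_iff[of xs Bs As] assms len that by auto
  with len show ?thesis
    by (simp add: list_eq_iff_nth_eq)
qed

lemma Inter_listset:
  assumes "\<And>i. length (As i) = n"
  shows "xs \<in> (\<Inter>i. listset (As i)) \<longleftrightarrow> length xs = n \<and> (\<forall>k<n. xs ! k \<in> (\<Inter>i. As i ! k))"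
  using assms by (auto simp: listset_iff)

text \<open>Reduces convergence of tuples of sets to convergence in each position, so that arguments
  can be selected or assembled freely. From left to right, the limit point lies in every product;
  all products are thus nonempty and determine their factors.\<close>

lemma converges_to_listset_iff:
  assumes As: "\<And>i. As i \<in> tuples n (Pow D)"
  shows "converges_to (tuples n D) (product_family n \<F>) (\<lambda>i. listset (As i)) a \<longleftrightarrow>
    length a = n \<and> (\<forall>k<n. converges_to D \<F> (\<lambda>i. As i ! k) (a ! k))"
    (is "?L \<longleftrightarrow> ?R")
proof
  have len: "length (As i) = n" for i
    using As[of i] by (simp add: tuples_iff)
  note Int = Inter_listset[of As n, OF len]
  show ?R if L: ?L
  proof -
    have Int_eq: "(\<Inter>i. listset (As i)) = {a}"
      using L by (simp add: converges_to_def)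
    have a: "a \<in> listset (As i)" for i
      using Int_eq by blast
    have la: "length a = n" and aD: "\<forall>k<n. a ! k \<in> D"
      using L by (auto simp: converges_to_def tuples_iff)
    \<comment> \<open>Membership in the product family only supplies some factors from
      \<open>\<F>\<close>; injectivity at the point \<open>a\<close> identifies them with
      \<open>As i\<close>.\<close>
    have fam: "As i \<in> tuples n \<F>" for i
    proof -
      have "listset (As i) \<in> product_family n \<F>"
        using L by (simp add: converges_to_def)
      then obtain Bs where "Bs \<in> tuples n \<F>" "listset (As i) = listset Bs"
        unfolding product_family_def by blast
      with listset_inj[OF a, of i Bs] show ?thesis by simp
    qed
    have "converges_to D \<F> (\<lambda>i. As i ! k) (a ! k)" if k: "k < n" for k
    proof -
      have "As (Suc i) ! k \<subseteq> As i ! k" for i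
      proof -
        have "listset (As (Suc i)) \<subseteq> listset (As i)"
          using L by (simp add: converges_to_def)
        then show ?thesis
          using listset_mono_iff[OF a[of "Suc i"], of "As i"] k by (simp add: len)
      qed
      moreover have "(\<Inter>i. As i ! k) = {a ! k}"
      proof (intro equalityI subsetI)
        fix y assume y: "y \<in> (\<Inter>i. As i ! k)"
        \<comment> \<open>A point \<open>y\<close> of the intersection of the factors at
          \<open>k\<close>, put into \<open>a\<close> at position \<open>k\<close>, gives a point of
          every product, hence \<open>a\<close> itself.\<close>
        have "a[k := y] \<in> listset (As i)" for i
          using a[of i] y la k by (auto simp: listset_iff nth_list_update len)
        then have "a[k := y] = a"
          using Int_eq by blast
        then show "y \<in> {a ! k}"
          using k la by (metis nth_list_update_eq singletonI)
      next
        fix y assume "y \<in> {a ! k}"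
        then show "y \<in> (\<Inter>i. As i ! k)"
          using a k len by (auto simp: listset_iff)
      qed
      ultimately show ?thesis
        using k fam As aD by (auto simp: converges_to_def tuples_iff)
    qed
    with la show ?R by blast
  qed
  show ?L if R: ?R
  proof -
    from R have la: "length a = n"
      and conv: "\<And>k. k < n \<Longrightarrow> converges_to D \<F> (\<lambda>i. As i ! k) (a ! k)"
      by auto
    have Int_k: "(\<Inter>i. As i ! k) = {a ! k}" if "k < n" for k
      using conv[OF that] by (simp add: converges_to_def)
    have "xs \<in> (\<Inter>i. listset (As i)) \<longleftrightarrow> xs = a" for xs
      \<comment> \<open>\<open>INT_iff\<close> is removed so that \<open>Int_k\<close> can rewrite
        each intersection as a whole.\<close>
      unfolding Int using la by (auto simp: Int_k list_eq_iff_nth_eq simp del: INT_iff)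
    then have "(\<Inter>i. listset (As i)) = {a}"
      by blast
    moreover have "listset (As i) \<subseteq> tuples n D" for i
      using As[of i] by (fastforce simp: tuples_iff listset_iff)
    moreover have "listset (As (Suc i)) \<subseteq> listset (As i)" for i
      using conv len by (fastforce simp: converges_to_def listset_iff)
    moreover have "listset (As i) \<in> product_family n \<F>" for i
      using conv len by (auto simp: converges_to_def product_family_def tuples_iff)
    moreover have "a \<in> tuples n D"
      using conv la by (auto simp: converges_to_def tuples_iff)
    ultimately show ?L
      by (simp add: converges_to_def)
  qed
qed

section \<open>Working rules for set extensions and continuity\<close>

text \<open>Replaces \<open>the (F As)\<close> by an explicit value \<open>B\<close> that carries
  the range condition and the inclusion together.\<close>

lemma set_extension_iff:
  "set_extension n D f F \<longleftrightarrow>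
     dom F = tuples n (Pow D) \<and>
     (\<forall>As \<in> tuples n (Pow D). \<exists>B \<subseteq> D. F As = Some B \<and>
        (\<forall>x \<in> listset As. \<forall>y. f x = Some y \<longrightarrow> y \<in> B))"
  (is "?L \<longleftrightarrow> ?R")
proof
  assume L: ?L
  then have dom: "dom F = tuples n (Pow D)"
    and ran: "ran F \<subseteq> Pow D"
    and ext: "\<And>As. As \<in> tuples n (Pow D) \<Longrightarrow> {y. \<exists>x \<in> listset As. f x = Some y} \<subseteq> the (F As)"
    by (auto simp: set_extension_def pfuns_def)
  have "\<exists>B \<subseteq> D. F As = Some B \<and> (\<forall>x \<in> listset As. \<forall>y. f x = Some y \<longrightarrow> y \<in> B)"
    if As: "As \<in> tuples n (Pow D)" for As
  proof -
    obtain B where B: "F As = Some B"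
      using As dom by blast
    then have "B \<subseteq> D"
      using ran by (auto simp: ran_def)
    with B ext[OF As] show ?thesis by auto
  qed
  with dom show ?R by blast
next
  assume R: ?R
  have "ran F \<subseteq> Pow D"
  proof
    fix B assume "B \<in> ran F"
    then obtain As where "F As = Some B" by (auto simp: ran_def)
    with R show "B \<in> Pow D" by (metis Pow_iff domI option.inject)
  qed
  moreover have "{y. \<exists>x \<in> listset As. f x = Some y} \<subseteq> the (F As)"
    if As: "As \<in> tuples n (Pow D)" for As
  proof -
    obtain B where "F As = Some B" "\<forall>x \<in> listset As. \<forall>y. f x = Some y \<longrightarrow> y \<in> B"
      using R As by blast
    then show ?thesis by auto
  qed
  ultimately show ?L
    using R by (simp add: set_extension_def pfuns_def)
qed

lemma set_extensionE:
  assumes "set_extension n D f F" and "As \<in> tuples n (Pow D)"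
  obtains B where "B \<subseteq> D" and "F As = Some B"
    and "\<And>x y. x \<in> listset As \<Longrightarrow> f x = Some y \<Longrightarrow> y \<in> B"
proof -
  have "\<exists>B \<subseteq> D. F As = Some B \<and> (\<forall>x \<in> listset As. \<forall>y. f x = Some y \<longrightarrow> y \<in> B)"
    using assms by (simp add: set_extension_iff)
  with that show ?thesis by blast
qed

text \<open>Continuity alone promises some limit; the extension property identifies it as
  \<open>y\<close>. Composition depends on this: the outer extension is known to be continuous only
  at points where the outer function is defined.\<close>

lemma continuous_set_extensionE:
  assumes "continuous_set_extension n D \<F> f F"
    and As: "\<And>i. As i \<in> tuples n (Pow D)"
    and conv: "converges_to (tuples n D) (product_family n \<F>) (\<lambda>i. listset (As i)) a"
    and y: "f a = Some y"
  obtains B where "\<And>i. F (As i) = Some (B i)" and "converges_to D \<F> B y"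
proof -
  have ext: "set_extension n D f F" and cont: "continuous_in n D \<F> F a"
    using assms(1) y by (auto simp: continuous_set_extension_def)
  obtain B b where B: "\<And>i. F (As i) = Some (B i)" and b: "converges_to D \<F> B b"
    using cont As conv unfolding continuous_in_def converges_def by blast
  have "y \<in> B i" for i
  proof -
    have "a \<in> listset (As i)"
      using conv unfolding converges_to_def by blast
    with set_extensionE[OF ext As[of i]] y B[of i] show ?thesis
      by (metis option.inject)
  qed
  moreover have "(\<Inter>i. B i) = {b}"
    using b by (simp add: converges_to_def)
  ultimately have "y = b"
    by blast
  with B b that show ?thesis by blast
qed

text \<open>The limit to be exhibited is the value \<open>y\<close> itself, in the form in which the
  elimination rule supplies limits.\<close>

lemma continuous_set_extensionI:
  assumes "set_extension n D f F"
    and "\<And>As a y. (\<And>i. As i \<in> tuples n (Pow D)) \<Longrightarrow>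
      converges_to (tuples n D) (product_family n \<F>) (\<lambda>i. listset (As i)) a \<Longrightarrow>
      f a = Some y \<Longrightarrow> \<exists>B. (\<forall>i. F (As i) = Some (B i)) \<and> converges_to D \<F> B y"
  shows "continuous_set_extension n D \<F> f F"
  unfolding continuous_set_extension_def continuous_in_def
proof (intro conjI ballI allI impI)
  fix a As
  assume "a \<in> dom f" and "(\<forall>i. As i \<in> tuples n (Pow D)) \<and>
    converges_to (tuples n D) (product_family n \<F>) (\<lambda>i. listset (As i)) a"
  then show "\<exists>B. (\<forall>i. F (As i) = Some (B i)) \<and> converges D \<F> B"
    using assms(2)[of As a] unfolding converges_def by blast
qed (rule assms(1))

section \<open>Selecting and duplicating arguments\<close>

text \<open>Precomposition with a selection of coordinates; a repeated index in \<open>js\<close>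
  duplicates an argument, a missing one drops it. The membership test fixes the arity and also
  constrains the dropped components.\<close>

definition reindex :: "nat \<Rightarrow> 'd set \<Rightarrow> nat list \<Rightarrow> ('d list \<rightharpoonup> 't) \<Rightarrow> ('d list \<rightharpoonup> 't)" where
  "reindex n D js f xs = (if xs \<in> tuples n D then f (map ((!) xs) js) else None)"

lemma map_nth_tuples:
  "xs \<in> tuples n D \<Longrightarrow> \<forall>j \<in> set js. j < n \<Longrightarrow> map ((!) xs) js \<in> tuples (length js) D"
  by (auto simp: tuples_iff)

text \<open>Selecting coordinates commutes with forming tuples of sets, and convergence is a
  condition on each coordinate separately, so it survives the selection.\<close>

lemma continuous_set_extension_reindex:
  assumes cse: "continuous_set_extension (length js) D \<F> f F" and js: "\<forall>j \<in> set js. j < n"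
  shows "continuous_set_extension n D \<F> (reindex n D js f) (reindex n (Pow D) js F)"
proof (rule continuous_set_extensionI)
  have ext: "set_extension (length js) D f F"
    using cse by (simp add: continuous_set_extension_def)
  have "dom F = tuples (length js) (Pow D)"
    using ext by (simp add: set_extension_def)
  then have "dom (reindex n (Pow D) js F) = tuples n (Pow D)"
    using map_nth_tuples[OF _ js] by (fastforce simp: reindex_def split: if_splits)
  moreover have "\<exists>B \<subseteq> D. reindex n (Pow D) js F As = Some B \<and>
      (\<forall>x \<in> listset As. \<forall>y. reindex n D js f x = Some y \<longrightarrow> y \<in> B)"
    if As: "As \<in> tuples n (Pow D)" for As
  proof -
    obtain B where "B \<subseteq> D" "F (map ((!) As) js) = Some B"
      and B: "\<And>x y. x \<in> listset (map ((!) As) js) \<Longrightarrow> f x = Some y \<Longrightarrow> y \<in> B"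
      using set_extensionE[OF ext map_nth_tuples[OF As js]] by blast
    \<comment> \<open>When \<open>js\<close> repeats an index, the selected tuples are in general
      only a diagonal part of the product; an extension needs no more than this inclusion.\<close>
    moreover have "map ((!) x) js \<in> listset (map ((!) As) js)" if "x \<in> listset As" for x
      using that js As by (auto simp: listset_iff tuples_iff)
    ultimately show ?thesis
      using As by (auto simp: reindex_def split: if_splits)
  qed
  ultimately show "set_extension n D (reindex n D js f) (reindex n (Pow D) js F)"
    unfolding set_extension_iff by blast
next
  fix As a y
  assume As: "\<And>i. As i \<in> tuples n (Pow D)"
    and conv: "converges_to (tuples n D) (product_family n \<F>) (\<lambda>i. listset (As i)) a"
    and y: "reindex n D js f a = Some y"
  let ?Bs = "\<lambda>i. map ((!) (As i)) js"
  have Bs: "?Bs i \<in> tuples (length js) (Pow D)" for i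
    by (rule map_nth_tuples[OF As js])
  have "converges_to (tuples (length js) D) (product_family (length js) \<F>)
      (\<lambda>i. listset (?Bs i)) (map ((!) a) js)"
    using conv js unfolding converges_to_listset_iff[OF As] converges_to_listset_iff[OF Bs] by simp
  moreover have "f (map ((!) a) js) = Some y"
    using y by (simp add: reindex_def split: if_splits)
  ultimately obtain B where "\<And>i. F (?Bs i) = Some (B i)" "converges_to D \<F> B y"
    using continuous_set_extensionE[where As = ?Bs, OF cse Bs] by blast
  with As show "\<exists>B. (\<forall>i. reindex n (Pow D) js F (As i) = Some (B i)) \<and> converges_to D \<F> B y"
    by (auto simp: reindex_def)
qed

section \<open>Composition with several inner functions\<close>

text \<open>Strict composition: one undefined inner function makes the result undefined. Keeping the
  inner functions in a list treats unary and binary operations alike.\<close>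

definition compose :: "('d list \<rightharpoonup> 't) \<Rightarrow> ('s \<rightharpoonup> 'd) list \<Rightarrow> ('s \<rightharpoonup> 't)" where
  "compose g fs x = (if \<forall>f \<in> set fs. f x \<noteq> None then g (map (\<lambda>f. the (f x)) fs) else None)"

lemma compose_eq:
  assumes "length ys = length fs" and "\<And>k. k < length fs \<Longrightarrow> (fs ! k) x = Some (ys ! k)"
  shows "compose g fs x = g ys"
proof -
  have "\<forall>f \<in> set fs. f x \<noteq> None"
    using assms(2) by (metis in_set_conv_nth option.distinct(1))
  moreover have "map (\<lambda>f. the (f x)) fs = ys"
    using assms by (auto simp: list_eq_iff_nth_eq)
  ultimately show ?thesis
    by (simp add: compose_def)
qed

lemma compose_eq_SomeE:
  assumes "compose g fs x = Some z"
  obtains ys where "length ys = length fs"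
    and "\<And>k. k < length fs \<Longrightarrow> (fs ! k) x = Some (ys ! k)" and "g ys = Some z"
proof
  have *: "\<forall>f \<in> set fs. f x \<noteq> None"
    using assms by (auto simp: compose_def split: if_splits)
  show "length (map (\<lambda>f. the (f x)) fs) = length fs"
    by simp
  show "(fs ! k) x = Some (map (\<lambda>f. the (f x)) fs ! k)" if "k < length fs" for k
    using * that by auto
  show "g (map (\<lambda>f. the (f x)) fs) = Some z"
    using assms * by (simp add: compose_def)
qed

text \<open>The inner extensions yield a tuple of sets whose product contains every tuple of inner
  values. At a point of the domain these sets converge, position by position, to the inner values,
  where the outer function is defined and its continuity applies.\<close>

lemma continuous_set_extension_compose:
  assumes g: "continuous_set_extension (length fs) D \<F> g G"
    and fs: "\<And>k. k < length fs \<Longrightarrow> continuous_set_extension n D \<F> (fs ! k) (Fs ! k)"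
    and len: "length Fs = length fs" and ne: "fs \<noteq> []"
  shows "continuous_set_extension n D \<F> (compose g fs) (compose G Fs)"
proof (rule continuous_set_extensionI)
  have ext_g: "set_extension (length fs) D g G"
    using g by (simp add: continuous_set_extension_def)
  have ext: "set_extension n D (fs ! k) (Fs ! k)" if "k < length fs" for k
    using fs[OF that] by (simp add: continuous_set_extension_def)
  have val: "\<exists>B \<subseteq> D. compose G Fs As = Some B \<and>
      (\<forall>x \<in> listset As. \<forall>y. compose g fs x = Some y \<longrightarrow> y \<in> B)"
    if As: "As \<in> tuples n (Pow D)" for As
  proof -
    have "\<exists>B. B \<subseteq> D \<and> (Fs ! k) As = Some B \<and>
        (\<forall>x \<in> listset As. \<forall>y. (fs ! k) x = Some y \<longrightarrow> y \<in> B)" if "k < length fs" for k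
      using set_extensionE[OF ext[OF that] As] by metis
    then obtain B where B: "\<And>k. k < length fs \<Longrightarrow> B k \<subseteq> D \<and> (Fs ! k) As = Some (B k) \<and>
        (\<forall>x \<in> listset As. \<forall>y. (fs ! k) x = Some y \<longrightarrow> y \<in> B k)"
      by metis
    define Bs where "Bs = map B [0..<length fs]"
    have Bs: "Bs \<in> tuples (length fs) (Pow D)"
      using B by (auto simp: Bs_def tuples_iff)
    obtain C where C: "C \<subseteq> D" "G Bs = Some C"
      and gC: "\<And>x y. x \<in> listset Bs \<Longrightarrow> g x = Some y \<Longrightarrow> y \<in> C"
      using set_extensionE[OF ext_g Bs] by blast
    have "compose G Fs As = Some C"
      using compose_eq[of Bs Fs As G] B C len by (simp add: Bs_def)
    moreover have "z \<in> C" if x: "x \<in> listset As" and z: "compose g fs x = Some z" for x z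
    proof -
      obtain ys where ys: "length ys = length fs"
          "\<And>k. k < length fs \<Longrightarrow> (fs ! k) x = Some (ys ! k)" "g ys = Some z"
        using compose_eq_SomeE[OF z] by blast
      have "ys \<in> listset Bs"
        using ys B x by (simp add: Bs_def listset_iff)
      with gC ys show ?thesis by blast
    qed
    ultimately show ?thesis
      using C by blast
  qed
  have "dom (compose G Fs) \<subseteq> tuples n (Pow D)"
  proof
    fix As assume "As \<in> dom (compose G Fs)"
    then obtain C where "compose G Fs As = Some C" by blast
    \<comment> \<open>A single inner extension already bounds the domain; the first one exists
      because \<open>fs\<close> is nonempty. With no inner functions the definedness test would be
      vacuous.\<close>
    then have "As \<in> dom (Fs ! 0)"
      using ne len by (auto elim!: compose_eq_SomeE)
    then show "As \<in> tuples n (Pow D)"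
      using ext[of 0] ne by (auto simp: set_extension_def)
  qed
  with val show "set_extension n D (compose g fs) (compose G Fs)"
    unfolding set_extension_iff by blast
next
  fix As a z
  assume As: "\<And>i. As i \<in> tuples n (Pow D)"
    and conv: "converges_to (tuples n D) (product_family n \<F>) (\<lambda>i. listset (As i)) a"
    and z: "compose g fs a = Some z"
  obtain ys where ys: "length ys = length fs" "g ys = Some z"
    and fs_ys: "\<And>k. k < length fs \<Longrightarrow> (fs ! k) a = Some (ys ! k)"
    using compose_eq_SomeE[OF z] by blast
  have "\<exists>B. (\<forall>i. (Fs ! k) (As i) = Some (B i)) \<and> converges_to D \<F> B (ys ! k)"
    if "k < length fs" for k
    using continuous_set_extensionE[OF fs[OF that] As conv fs_ys[OF that]] by metis
  then obtain B where B: "\<And>k i. k < length fs \<Longrightarrow> (Fs ! k) (As i) = Some (B k i)"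
    and convB: "\<And>k. k < length fs \<Longrightarrow> converges_to D \<F> (B k) (ys ! k)"
    by metis
  define Bs where "Bs i = map (\<lambda>k. B k i) [0..<length fs]" for i
  have Bs: "Bs i \<in> tuples (length fs) (Pow D)" for i
    using convB by (auto simp: Bs_def tuples_iff converges_to_def)
  \<comment> \<open>The componentwise criterion assembles the separate inner limits into the single
    limit \<open>ys\<close>, at which \<open>g\<close> has the value \<open>z\<close>.\<close>
  have "converges_to (tuples (length fs) D) (product_family (length fs) \<F>)
      (\<lambda>i. listset (Bs i)) ys"
    unfolding converges_to_listset_iff[OF Bs] using ys convB by (simp add: Bs_def)
  then obtain C where "\<And>i. G (Bs i) = Some (C i)" "converges_to D \<F> C z"
    using continuous_set_extensionE[where As = Bs, OF g Bs] ys by blast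
  moreover have "compose G Fs (As i) = G (Bs i)" for i
    by (rule compose_eq) (use B len in \<open>simp_all add: Bs_def\<close>)
  ultimately show "\<exists>B. (\<forall>i. compose G Fs (As i) = Some (B i)) \<and> converges_to D \<F> B z"
    by auto
qed

section \<open>Computed functions as compositions\<close>

text \<open>Inverts indexing into the variable sequence, which has no repetitions; the value is
  unspecified for variables outside \<open>e\<close>.\<close>

definition var_index :: "('v, 'u, 'b) expr \<Rightarrow> 'v \<Rightarrow> nat" where
  "var_index e v = the (map_of (zip (varseq e) [0..<length (varseq e)]) v)"

lemma var_index:
  assumes "v \<in> vars e"
  shows "var_index e v < length (varseq e)" and "varseq e ! var_index e v = v"
proof -
  obtain k where "k < length (varseq e)" "varseq e ! k = v"
    using assms by (metis in_set_conv_nth set_varseq)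
  then show "var_index e v < length (varseq e)" "varseq e ! var_index e v = v"
    using map_of_zip_nth[of "varseq e" "[0..<length (varseq e)]" k] by (auto simp: var_index_def)
qed

text \<open>Both halves are selections of coordinates, the form that \<open>reindex\<close> handles:
  the variable sequence of the compound expression starts with that of \<open>e1\<close>, and each
  variable of \<open>e2\<close> has a position in it.\<close>

lemma distribution_eq:
  assumes "xs \<in> tuples (length (varseq (Binary p e1 e2))) D"
  shows "distribution e1 e2 D xs =
    Some (map ((!) xs) [0..<length (varseq e1)],
      map ((!) xs) (map (var_index (Binary p e1 e2)) (varseq e2)))"
proof -
  let ?e = "Binary p e1 e2"
  define us where "us = varseq ?e"
  have us: "varseq e1 @ filter (\<lambda>w. w \<notin> set (varseq e1)) (varseq e2) = us"
    unfolding us_def by (simp only: varseq_simps)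
  have len: "length xs = length us"
    using assms by (simp add: us_def tuples_def)
  \<comment> \<open>Since \<open>us\<close> is distinct, looking \<open>w\<close> up by
    \<open>map_of\<close> selects the component at its position.\<close>
  have "the (map_of (zip us xs) w) = xs ! var_index ?e w" if "w \<in> vars e2" for w
    using map_of_zip_nth[of us xs "var_index ?e w"] var_index[of w ?e] that len
    by (simp add: us_def del: varseq_simps)
  moreover have "take (length (varseq e1)) xs = map ((!) xs) [0..<length (varseq e1)]"
    by (rule nth_equalityI) (simp_all add: len us_def)
  ultimately show ?thesis
    using assms unfolding distribution_def us Let_def us_def by simp
qed

lemma computed_Unary: "computed I (Unary p e) = compose (un_op I p) [computed I e]"
  by (rule ext) (simp add: compose_def map_comp_def split: option.split)

text \<open>The two operands may have different arities; reindexing turns both into functions of the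
  variables of the whole expression, so that the composition lemma applies.\<close>

lemma computed_Binary:
  fixes p e1 e2 I
  defines "e \<equiv> Binary p e1 e2"
  shows "computed I e = compose (bin_op I p)
    [reindex (length (varseq e)) (idom I) [0..<length (varseq e1)] (computed I e1),
     reindex (length (varseq e)) (idom I) (map (var_index e) (varseq e2)) (computed I e2)]"
    (is "_ = compose _ ?fs")
proof (rule ext)
  fix xs
  show "computed I e xs = compose (bin_op I p) ?fs xs"
  proof (cases "xs \<in> tuples (length (varseq e)) (idom I)")
    case True
    define as bs where "as = map ((!) xs) [0..<length (varseq e1)]"
      and "bs = map ((!) xs) (map (var_index e) (varseq e2))"
    have "distribution e1 e2 (idom I) xs = Some (as, bs)"
      unfolding e_def as_def bs_def by (rule distribution_eq[OF True[unfolded e_def]])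
    then have "computed I e xs =
        (case (computed I e1 as, computed I e2 bs) of
          (Some y, Some z) \<Rightarrow> bin_op I p [y, z] | _ \<Rightarrow> None)"
      by (simp add: e_def map_comp_def prod_pfun_def split: option.split)
    with True show ?thesis
      by (simp add: compose_def reindex_def as_def[symmetric] bs_def[symmetric]
          del: varseq_simps map_map split: option.split)
  next
    case False
    \<comment> \<open>Off the tuples of the right length over the domain, both sides are undefined:
      the left through \<open>distribution\<close>, the right through the test in
      \<open>reindex\<close>.\<close>
    then have "distribution e1 e2 (idom I) xs = None"
      by (simp add: e_def distribution_def)
    with False show ?thesis
      by (simp add: e_def compose_def reindex_def map_comp_def del: varseq_simps)
  qed
qed

section \<open>Induction over expressions\<close>

text \<open>Both functions return the only component of their argument, so convergence of the values
  is the componentwise criterion at position 0.\<close>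

lemma continuous_set_extension_Var:
  assumes "idom I = D" and "idom I' = Pow D"
  shows "continuous_set_extension 1 D \<F> (computed I (Var v)) (computed I' (Var v))"
proof (rule continuous_set_extensionI)
  have "\<exists>B \<subseteq> D. computed I' (Var v) As = Some B \<and>
      (\<forall>x \<in> listset As. \<forall>y. computed I (Var v) x = Some y \<longrightarrow> y \<in> B)"
    if As: "As \<in> tuples 1 (Pow D)" for As
  proof -
    obtain A where "As = [A]" "A \<subseteq> D"
      using As by (auto simp: tuples_def length_Suc_conv)
    then show ?thesis
      using assms As by (auto simp: set_Cons_def split: if_splits)
  qed
  moreover have "dom (computed I' (Var v)) = tuples 1 (Pow D)"
    using assms by (auto split: if_splits)
  ultimately show "set_extension 1 D (computed I (Var v)) (computed I' (Var v))"
    unfolding set_extension_iff by blast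
next
  fix As a y
  assume As: "\<And>i. As i \<in> tuples 1 (Pow D)"
    and conv: "converges_to (tuples 1 D) (product_family 1 \<F>) (\<lambda>i. listset (As i)) a"
    and y: "computed I (Var v) a = Some y"
  have "computed I' (Var v) (As i) = Some (As i ! 0)" for i
    using As[of i] assms(2) by (auto simp: tuples_def length_Suc_conv)
  moreover have "y = a ! 0"
    using y by (auto simp: tuples_def length_Suc_conv split: if_splits)
  moreover have "converges_to D \<F> (\<lambda>i. As i ! 0) (a ! 0)"
    using conv unfolding converges_to_listset_iff[OF As] by simp
  ultimately show "\<exists>B. (\<forall>i. computed I' (Var v) (As i) = Some (B i)) \<and> converges_to D \<F> B y"
    by auto
qed

lemma continuous_set_extension_computed:
  assumes "idom I = D" and "idom I' = Pow D"
    and "\<forall>p \<in> unops e. continuous_set_extension 1 D \<F> (un_op I p) (un_op I' p)"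
    and "\<forall>p \<in> binops e. continuous_set_extension 2 D \<F> (bin_op I p) (bin_op I' p)"
  shows "continuous_set_extension (length (varseq e)) D \<F> (computed I e) (computed I' e)"
  \<comment> \<open>The conditions on operation symbols mention \<open>e\<close>, so they enter the
    induction as premises and are restricted to each subexpression.\<close>
  using assms(3,4)
proof (induction e)
  case (Var v)
  then show ?case
    using continuous_set_extension_Var[OF assms(1,2)] by simp
next
  case (Unary p e)
  then show ?case
    unfolding computed_Unary by (intro continuous_set_extension_compose) auto
next
  case (Binary p e1 e2)
  let ?e = "Binary p e1 e2"
  let ?n = "length (varseq ?e)"
  let ?js1 = "[0..<length (varseq e1)]" and ?js2 = "map (var_index ?e) (varseq e2)"
  have "continuous_set_extension ?n D \<F> (reindex ?n D ?js1 (computed I e1))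
      (reindex ?n (Pow D) ?js1 (computed I' e1))"
    using Binary by (intro continuous_set_extension_reindex) auto
  moreover have "continuous_set_extension ?n D \<F> (reindex ?n D ?js2 (computed I e2))
      (reindex ?n (Pow D) ?js2 (computed I' e2))"
    \<comment> \<open>Variables of \<open>e2\<close> are variables of \<open>?e\<close>, so their
      positions lie below \<open>?n\<close>.\<close>
    using Binary var_index(1)[of _ ?e]
    by (intro continuous_set_extension_reindex) (auto simp del: varseq_simps)
  ultimately show ?case
    using Binary.prems unfolding computed_Binary assms(1,2)
    by (intro continuous_set_extension_compose)
      \<comment> \<open>Writing 2 as a successor matches the arity to the list of two operands and
        splits the index bound into its two cases.\<close>
      (auto simp: less_Suc_eq numeral_2_eq_2 simp del: varseq_simps)
qed

theorem theorem3:
  fixes D :: "'d set" and \<F> :: "'d set set"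
    and e :: "('v, 'u, 'b) expr"
    and I :: "('u, 'b, 'd) interp" and I' :: "('u, 'b, 'd set) interp"
    and f :: "'d list \<rightharpoonup> 'd" and F :: "'d set list \<rightharpoonup> 'd set"
  assumes "\<F> \<subseteq> Pow D"
    and "interpretation_for e I" and "idom I = D"
    and "continuous_set_extension_interp e \<F> I I'"
    and "f = computed I e" and "F = computed I' e"
  shows "continuous_set_extension (length (varseq e)) D \<F> f F"
  using assms continuous_set_extension_computed[of I D I' e \<F>]
  by (auto simp: continuous_set_extension_interp_def set_extension_interp_def)

end
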